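(* Let $n$ be a natural number, let $\mathbb{F}_n$ denote the free group on $n$ generators, let $G$ be a group containing $\mathbb{F}_n$ as a subgroup of finite index, and let $S$ be a finite symmetric generating set for $G$ not containing the identity. Then the Cayley graph $\mathrm{Cay}(G,S)$ is minor excluded.
   Context: Cayley graph: for a group $G$ and a finite generating set $S$ that is symmetric ($s\in S$ iff $s^{-1}\in S$) and does not contain the identity, $\mathrm{Cay}(G,S)$ is the graph with vertex set $G$ in which $u,v\in G$ are adjacent if and only if $u=sv$ for some $s\in S$. Minor: a finite graph $M$ is a minor of a connected graph $\Gamma$ if there is a finite set $\{V_i\}$ of pairwise-disjoint (nonempty) finite connected subgraphs of $\Gamma$ (branch sets), in one-to-one correspondence with the set of vertices $\{v_i\}$ of $M$, such that for every edge of $M$ between $v_i$ and $v_j$ there is an edge of $\Gamma$ between $V_i$ and $V_j$. The graph $\Gamma$ is minor excluded if there is a finite graph that is not a minor of $\Gamma$; equivalently, if there is a natural number $m$ such that the complete graph $K_m$ is not a minor of $\Gamma$. *)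

theory Defs
  imports "HOL-Algebra.Algebra" "Graph_Theory.Graph_Theory"
begin

section \<open>Free groups\<close>

text \<open>
  The letter \<open>(i, True)\<close> stands for the generator \<open>x\<^sub>i\<close>, and \<open>(i, False)\<close> for its inverse.
  The free group on \<open>n\<close> generators consists of the reduced words in the letters with \<open>i < n\<close>;
  a product is obtained by concatenating and cancelling, here by
  pushing the letters of the first word, from right to left, onto the second word.
\<close>

type_synonym letter = "nat \<times> bool"

definition inv_letter :: "letter \<Rightarrow> letter" where
  "inv_letter a = (fst a, \<not> snd a)"

definition reduced_word :: "letter list \<Rightarrow> bool" where
  "reduced_word w \<longleftrightarrow> successively (\<lambda>a b. b \<noteq> inv_letter a) w"

definition push_letter :: "letter \<Rightarrow> letter list \<Rightarrow> letter list" where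
  "push_letter a w =
    (case w of [] \<Rightarrow> [a] | b # v \<Rightarrow> if b = inv_letter a then v else a # w)"

definition free_group :: "nat \<Rightarrow> letter list monoid" where
  "free_group n =
    \<lparr>carrier = {w. set w \<subseteq> {..<n} \<times> UNIV \<and> reduced_word w},
     monoid.mult = (\<lambda>u v. foldr push_letter u v),
     one = []\<rparr>"

lemma inv_letter_inv_letter [simp]: "inv_letter (inv_letter a) = a"
  by (simp add: inv_letter_def)

lemma inv_letter_neq [simp]: "inv_letter a \<noteq> a" "a \<noteq> inv_letter a"
  by (auto simp: inv_letter_def prod_eq_iff)

lemma reduced_word_Nil [simp]: "reduced_word []"
  by (simp add: reduced_word_def)

lemma reduced_word_Cons:
  "reduced_word (a # w) \<longleftrightarrow> reduced_word w \<and> (w = [] \<or> hd w \<noteq> inv_letter a)"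
  by (auto simp: reduced_word_def successively_Cons)

lemma reduced_word_push [simp]: "reduced_word w \<Longrightarrow> reduced_word (push_letter a w)"
  by (auto simp: push_letter_def reduced_word_Cons split: list.splits)

lemma set_push: "set (push_letter a w) \<subseteq> insert a (set w)"
  by (auto simp: push_letter_def split: list.splits)

lemma push_push_inv [simp]:
  "reduced_word w \<Longrightarrow> push_letter a (push_letter (inv_letter a) w) = w"
  by (auto simp: push_letter_def reduced_word_Cons split: list.splits)

lemma push_inv_push [simp]:
  "reduced_word w \<Longrightarrow> push_letter (inv_letter a) (push_letter a w) = w"
  using push_push_inv[of w "inv_letter a"] by simp

lemma reduced_word_foldr_push [simp]:
  "reduced_word v \<Longrightarrow> reduced_word (foldr push_letter u v)"
  by (induction u) auto

lemma set_foldr_push: "set (foldr push_letter u v) \<subseteq> set u \<union> set v"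
  by (induction u) (use set_push in fastforce)+

lemma foldr_push_Nil: "reduced_word u \<Longrightarrow> foldr push_letter u [] = u"
  by (induction u) (auto simp: reduced_word_Cons push_letter_def split: list.splits)

lemma foldr_push_push:
  assumes "reduced_word w"
  shows "foldr push_letter (push_letter a u) w = push_letter a (foldr push_letter u w)"
proof (cases u)
  case (Cons b v)
  have "reduced_word (foldr push_letter v w)"
    using assms by simp
  with Cons show ?thesis
    by (simp add: push_letter_def[of a "b # v"])
qed (simp add: push_letter_def)

lemma foldr_push_assoc:
  assumes "reduced_word w"
  shows "foldr push_letter (foldr push_letter u v) w = foldr push_letter u (foldr push_letter v w)"
  by (induction u) (simp_all add: foldr_push_push assms)

lemma foldr_push_inverse:
  "reduced_word v \<Longrightarrow> foldr push_letter (map inv_letter (rev u)) (foldr push_letter u v) = v"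
  by (induction u arbitrary: v) simp_all

lemma group_free_group: "group (free_group n)"
proof (rule groupI)
  fix u assume u: "u \<in> carrier (free_group n)"
  define v where "v = foldr push_letter (map inv_letter (rev u)) []"
  have "set v \<subseteq> inv_letter ` set u"
    using set_foldr_push[of "map inv_letter (rev u)" "[]"] by (simp add: v_def)
  moreover have "inv_letter ` set u \<subseteq> {..<n} \<times> UNIV"
    using u by (auto simp: free_group_def inv_letter_def)
  ultimately have "v \<in> carrier (free_group n)"
    by (simp add: free_group_def v_def)
  moreover have "foldr push_letter v u = []"
  proof -
    have "foldr push_letter v u = foldr push_letter (map inv_letter (rev u)) (foldr push_letter [] u)"
      unfolding v_def using u by (intro foldr_push_assoc) (simp add: free_group_def)
    also have "\<dots> = foldr push_letter (map inv_letter (rev u)) (foldr push_letter u [])"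
      using u by (simp add: free_group_def foldr_push_Nil)
    finally show ?thesis by (simp add: foldr_push_inverse)
  qed
  ultimately show "\<exists>v\<in>carrier (free_group n). v \<otimes>\<^bsub>free_group n\<^esub> u = \<one>\<^bsub>free_group n\<^esub>"
    by (auto simp: free_group_def)
next
  fix u v assume "u \<in> carrier (free_group n)" "v \<in> carrier (free_group n)"
  then show "u \<otimes>\<^bsub>free_group n\<^esub> v \<in> carrier (free_group n)"
    using set_foldr_push[of u v] by (auto simp: free_group_def)
qed (auto simp: free_group_def foldr_push_assoc)


section \<open>Cayley graphs\<close>

text \<open>
  Simple graphs are symmetric loop-free digraphs whose arcs are pairs of vertices; the locale
  \<^locale>\<open>pair_graph\<close> additionally requires finiteness.
\<close>

definition symmetric_generating_set :: "('a, 'b) monoid_scheme \<Rightarrow> 'a set \<Rightarrow> bool" where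
  "symmetric_generating_set G S \<longleftrightarrow>
     finite S \<and> S \<subseteq> carrier G \<and> generate G S = carrier G \<and>
     (\<forall>s\<in>carrier G. s \<in> S \<longleftrightarrow> inv\<^bsub>G\<^esub> s \<in> S) \<and> \<one>\<^bsub>G\<^esub> \<notin> S"

definition cayley_graph :: "('a, 'b) monoid_scheme \<Rightarrow> 'a set \<Rightarrow> 'a pair_pre_digraph" where
  "cayley_graph G S =
    \<lparr>pverts = carrier G,
     parcs = {(u, v). u \<in> carrier G \<and> v \<in> carrier G \<and> (\<exists>s\<in>S. u = s \<otimes>\<^bsub>G\<^esub> v)}\<rparr>"

lemma (in group) pair_bidirected_digraph_cayley_graph:
  assumes "symmetric_generating_set G S"
  shows "pair_bidirected_digraph (cayley_graph G S)"
proof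
  show "symmetric (with_proj (cayley_graph G S))"
    unfolding symmetric_def with_proj_simps
  proof (rule symI)
    fix u v assume "(u, v) \<in> parcs (cayley_graph G S)"
    then obtain s where s: "u \<in> carrier G" "v \<in> carrier G" "s \<in> S" "u = s \<otimes> v"
      by (auto simp: cayley_graph_def)
    with assms have "s \<in> carrier G" "inv s \<in> S"
      by (auto simp: symmetric_generating_set_def)
    have "v = inv s \<otimes> u"
      unfolding \<open>u = s \<otimes> v\<close> using \<open>s \<in> carrier G\<close> s(2) by (simp flip: m_assoc)
    with \<open>inv s \<in> S\<close> have "\<exists>t\<in>S. v = t \<otimes> u"
      by blast
    with s(1,2) show "(v, u) \<in> parcs (cayley_graph G S)"
      by (simp add: cayley_graph_def)
  qed
next
  fix e assume e: "e \<in> parcs (cayley_graph G S)"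
  then obtain s where s: "fst e \<in> carrier G" "snd e \<in> carrier G" "s \<in> S" "fst e = s \<otimes> snd e"
    by (auto simp: cayley_graph_def)
  with assms have "s \<in> carrier G" "s \<noteq> \<one>"
    by (auto simp: symmetric_generating_set_def)
  with s show "fst e \<noteq> snd e"
    by (metis r_cancel_one)
qed (auto simp: cayley_graph_def)

lemma (in group) connected_cayley_graph:
  assumes S: "symmetric_generating_set G S"
  shows "connected (with_proj (cayley_graph G S))"
proof -
  interpret C: pair_bidirected_digraph "cayley_graph G S"
    by (rule pair_bidirected_digraph_cayley_graph[OF S])
  let ?C = "with_proj (cayley_graph G S)"
  have arc: "(s \<otimes> v) \<rightarrow>\<^sup>*\<^bsub>?C\<^esub> v" if "s \<in> S" "v \<in> carrier G" for s v
    using that S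
    by (intro C.reachable_adjI) (auto simp: cayley_graph_def symmetric_generating_set_def)
  have gen: "(h \<otimes> v) \<rightarrow>\<^sup>*\<^bsub>?C\<^esub> v" if "h \<in> generate G S" "v \<in> carrier G" for h v
    using that
  proof (induction arbitrary: v rule: generate.induct)
    case one
    have "v \<in> verts ?C" using one by (simp add: cayley_graph_def)
    then show ?case using one by (simp add: C.reachable_refl)
  next
    case (inv h)
    then have "inv h \<in> S" using S by (auto simp: symmetric_generating_set_def)
    then show ?case using inv by (intro arc)
  next
    case (eng h1 h2)
    have c: "h1 \<in> carrier G" "h2 \<in> carrier G"
      using eng.hyps S by (auto simp: symmetric_generating_set_def)
    have "(h1 \<otimes> (h2 \<otimes> v)) \<rightarrow>\<^sup>*\<^bsub>?C\<^esub> (h2 \<otimes> v)" using eng.IH(1) c eng.prems by simp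
    also have "(h2 \<otimes> v) \<rightarrow>\<^sup>*\<^bsub>?C\<^esub> v" using eng.IH(2) eng.prems by simp
    finally show ?case using c eng.prems by (simp add: m_assoc)
  qed (rule arc)
  have "strongly_connected ?C"
    unfolding strongly_connected_def
  proof (intro conjI ballI)
    show "verts ?C \<noteq> {}" by (auto simp: cayley_graph_def)
    fix u v assume "u \<in> verts ?C" "v \<in> verts ?C"
    then have uv: "u \<in> carrier G" "v \<in> carrier G" by (auto simp: cayley_graph_def)
    then have "u \<otimes> inv v \<in> generate G S" using S by (auto simp: symmetric_generating_set_def)
    from gen[OF this, of v] uv show "u \<rightarrow>\<^sup>*\<^bsub>?C\<^esub> v" by (simp add: m_assoc)
  qed
  then show ?thesis
    by (auto simp: connected_def strongly_connected_def intro: C.reachable_mk_symmetricI)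
qed


section \<open>Minors\<close>

text \<open>
  The branch set of the vertex \<open>i\<close> of \<open>M\<close> is the finite graph \<open>B i\<close>. It is nonempty because
  \<^const>\<open>connected\<close> excludes the null graph.
\<close>

definition is_minor :: "'v pair_pre_digraph \<Rightarrow> 'a pair_pre_digraph \<Rightarrow> bool" where
  "is_minor M \<Gamma> \<longleftrightarrow>
    (\<exists>B :: 'v \<Rightarrow> 'a pair_pre_digraph.
      (\<forall>i\<in>pverts M. pair_graph (B i) \<and> subgraph (with_proj (B i)) (with_proj \<Gamma>) \<and>
         connected (with_proj (B i))) \<and>
      (\<forall>i\<in>pverts M. \<forall>j\<in>pverts M. i \<noteq> j \<longrightarrow> pverts (B i) \<inter> pverts (B j) = {}) \<and>
      (\<forall>(i, j)\<in>parcs M. \<exists>x\<in>pverts (B i). \<exists>y\<in>pverts (B j). (x, y) \<in> parcs \<Gamma>))"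

text \<open>Every finite graph is isomorphic to one whose vertices are natural numbers.\<close>

definition minor_excluded :: "'a pair_pre_digraph \<Rightarrow> bool" where
  "minor_excluded \<Gamma> \<longleftrightarrow> (\<exists>M :: nat pair_pre_digraph. pair_graph M \<and> \<not> is_minor M \<Gamma>)"

end

theory Submission
  imports Defs "HOL-Library.Sublist"
begin

text \<open>
  Writing each \<open>u \<in> G\<close> as \<open>t \<cdot> h\<close> with \<open>t\<close> in a finite transversal and \<open>h \<in> H\<close> gives a map from
  the Cayley graph to the tree of words, in which the parent of \<open>a # w\<close> is \<open>w\<close>; it has bounded
  fibres and moves adjacent vertices at most a bounded distance \<open>L\<close> apart. Given the branch sets of
  a complete minor, let \<open>p\<close> be a longest word such that some branch set maps into the subtree
  below \<open>p\<close>. Every other branch set touches that one, and by maximality of \<open>p\<close> it is not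
  contained in the subtree below a single child of \<open>p\<close>; being connected, it must then contain a
  vertex mapped within distance \<open>L + 1\<close> of \<open>p\<close>. Such vertices are uniformly bounded in number,
  hence so are the disjoint branch sets.
\<close>

section \<open>Nearness in the tree of words\<close>

text \<open>The word \<open>c\<close> is a common ancestor, at most \<open>L\<close> steps above
  each of \<open>u\<close> and \<open>v\<close>. This is tree distance up to a factor of
  two.\<close>

definition near :: "nat \<Rightarrow> 'b list \<Rightarrow> 'b list \<Rightarrow> bool" where
  "near L u v \<longleftrightarrow> (\<exists>a b c. u = a @ c \<and> v = b @ c \<and> length a \<le> L \<and> length b \<le> L)"

lemma near_refl: "near L u u"
  unfolding near_def by (metis append_Nil le0 list.size(3))

lemma near_sym: "near L u v \<Longrightarrow> near L v u"
  unfolding near_def by blast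

lemma near_mono: "near L u v \<Longrightarrow> L \<le> K \<Longrightarrow> near K u v"
  unfolding near_def by (elim exE conjE, intro exI conjI) (assumption | rule order.trans)+

text \<open>Passing to the parent costs one step: if \<open>x # u\<close> is itself the common
  ancestor, then \<open>u\<close> replaces it and \<open>v\<close> lies one step further
  below.\<close>

lemma near_Cons: "near L (x # u) v \<Longrightarrow> near (Suc L) u v"
proof -
  assume "near L (x # u) v"
  then obtain a b c where *: "x # u = a @ c" "v = b @ c" "length a \<le> L" "length b \<le> L"
    unfolding near_def by blast
  show ?thesis
  proof (cases a)
    case Nil
    then have "u = [] @ u" "v = (b @ [x]) @ u" "length (b @ [x]) \<le> Suc L"
      using * by auto
    then show ?thesis unfolding near_def by (metis le0 list.size(3))
  next
    case (Cons y a')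
    then have "u = a' @ c" "length a' \<le> Suc L" "length b \<le> Suc L" using * by auto
    then show ?thesis unfolding near_def using *(2) by blast
  qed
qed

lemma near_to_Cons: "near L u v \<Longrightarrow> near (Suc L) (x # u) v"
  unfolding near_def by (metis append_Cons le_Suc_eq length_Cons not_less_eq_eq)

lemma near_push_letter: "near L u v \<Longrightarrow> near (Suc L) (push_letter x u) v"
  using near_to_Cons[of L u v x]
  by (cases u) (auto simp: push_letter_def intro: near_Cons)

text \<open>Each push moves to the parent (cancellation) or to a child, so the product is reached by
  \<open>length w\<close> steps in the tree.\<close>

lemma near_foldr_push: "near (length w) (foldr push_letter w u) u"
  by (induction w) (auto intro: near_refl near_push_letter)

text \<open>The vertex \<open>p\<close> lies above \<open>u\<close> but not above the common
  ancestor \<open>c\<close>, since otherwise it would lie above \<open>v\<close>. So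
  \<open>p\<close> is on the path from \<open>u\<close> up to \<open>c\<close>.\<close>

lemma near_cross_suffix:
  assumes "near L u v" "suffix p u" "\<not> suffix p v"
  shows "near L p u \<and> near L p v"
proof -
  obtain a b c where *: "u = a @ c" "v = b @ c" "length a \<le> L" "length b \<le> L"
    using assms(1) unfolding near_def by blast
  have "\<not> suffix p c"
    using assms(3) * by (auto simp: suffix_append)
  then obtain d where d: "p = d @ c" "suffix d a"
    using assms(2) * by (auto simp: suffix_append)
  then have "length d \<le> L"
    using * suffix_length_le by fastforce
  then show ?thesis
    unfolding near_def using * d by blast
qed

text \<open>A word near \<open>p\<close> arises by dropping at most \<open>L\<close> letters and
  prepending at most \<open>L\<close> letters from \<open>A\<close>. The number of such choices does
  not depend on \<open>p\<close>.\<close>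

lemma card_near_le:
  assumes "finite A"
  obtains N where "\<And>p. finite {w. set w \<subseteq> A \<and> near L p w}"
    and "\<And>p. card {w. set w \<subseteq> A \<and> near L p w} \<le> N"
proof -
  define F where "F = {b. set b \<subseteq> A \<and> length b \<le> L} \<times> {..L}"
  have F: "finite F"
    unfolding F_def using finite_lists_length_le[OF assms] by auto
  have sub: "{w. set w \<subseteq> A \<and> near L p w} \<subseteq> (\<lambda>(b, k). b @ drop k p) ` F" for p
  proof clarify
    fix w assume w: "set w \<subseteq> A" "near L p w"
    then obtain a b c where *: "p = a @ c" "w = b @ c" "length a \<le> L" "length b \<le> L"
      unfolding near_def by blast
    then have "w = (\<lambda>(b, k). b @ drop k p) (b, length a)" "(b, length a) \<in> F"
      using w by (auto simp: F_def)
    then show "w \<in> (\<lambda>(b, k). b @ drop k p) ` F" by blast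
  qed
  show thesis
  proof
    show "finite {w. set w \<subseteq> A \<and> near L p w}" for p
      using finite_subset[OF sub] F by blast
    show "card {w. set w \<subseteq> A \<and> near L p w} \<le> card F" for p
      using surj_card_le[OF F sub] .
  qed
qed


section \<open>Graphs mapping to the tree of words\<close>

lemma connected_arc_cross:
  assumes "connected (with_proj B)" "x \<in> pverts B" "y \<in> pverts B" "P x" "\<not> P y"
  obtains u v where "(u, v) \<in> parcs B" "P u \<noteq> P v"
proof (rule ccontr)
  assume none: "\<not> thesis"
  have inv: "P u = P v" if "(u, v) \<in> parcs B" for u v
    using none that \<open>\<And>u v. (u, v) \<in> parcs B \<Longrightarrow> P u \<noteq> P v \<Longrightarrow> thesis\<close> by blast
  \<comment> \<open>Connectedness gives a walk in the symmetric closure; \<open>inv\<close> applies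
    to an arc in either direction.\<close>
  have "x \<rightarrow>\<^sup>*\<^bsub>with_proj (mk_symmetric (with_proj B))\<^esub> y"
    using assms(1-3) by (auto simp: connected_def strongly_connected_def)
  then have "(x, y) \<in> rtrancl_on (pverts B) (parcs (mk_symmetric (with_proj B)))"
    by (simp add: reachable_def)
  then have "P x = P y"
  proof induction
    case (step y z)
    then show ?case
      using inv by (auto simp: mk_symmetric_def)
  qed simp
  with assms show False by simp
qed

text \<open>Here \<open>x\<close> may lie outside \<open>B\<close>. If \<open>f y\<close> is not
  below \<open>p\<close>, the step from \<open>x\<close> to \<open>y\<close> already crosses near
  \<open>p\<close>. If \<open>f y\<close> is strictly below \<open>p\<close>, it is below a child
  \<open>a # p\<close>; by \<open>max\<close>, \<open>B\<close> leaves that subtree, and the arc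
  where it does so is near \<open>a # p\<close>.\<close>

lemma connected_near_word:
  fixes f :: "'a \<Rightarrow> 'b list"
  assumes conn: "connected (with_proj B)"
    and near: "\<And>u v. (u, v) \<in> parcs B \<Longrightarrow> near L (f u) (f v)"
    and verts: "parcs B \<subseteq> pverts B \<times> pverts B"
    and y: "y \<in> pverts B" and xy: "near L (f x) (f y)" and x: "suffix p (f x)"
    and max: "\<And>a. \<exists>z\<in>pverts B. \<not> suffix (a # p) (f z)"
  shows "\<exists>z\<in>pverts B. near (Suc L) p (f z)"
proof -
  have cross: "\<exists>z\<in>pverts B. near L q (f z)"
    if z: "z1 \<in> pverts B" "z2 \<in> pverts B" "suffix q (f z1)" "\<not> suffix q (f z2)" for q z1 z2
  proof -
    obtain u v where uv: "(u, v) \<in> parcs B" "suffix q (f u) \<noteq> suffix q (f v)"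
      by (rule connected_arc_cross[OF conn z(1,2), where P = "\<lambda>z. suffix q (f z)"]) (use z in blast)+
    then have "near L q (f u)"
      using near[OF uv(1)] near_sym near_cross_suffix by metis
    then show ?thesis using uv verts by blast
  qed
  show ?thesis
  proof (cases "suffix p (f y)")
    case False
    then show ?thesis
      using near_cross_suffix[OF xy x] y near_mono[of L p "f y" "Suc L"] by auto
  next
    case True
    show ?thesis
    proof (cases "f y = p")
      case True
      then show ?thesis using y near_refl by metis
    next
      case False
      then obtain e a where "f y = e @ a # p"
        using True by (metis append_Nil append_assoc append_Cons rev_exhaust suffix_def)
      then have "suffix (a # p) (f y)" by (simp add: suffix_def)
      then obtain z where "z \<in> pverts B" "near L (a # p) (f z)"
        using cross y max by blast
      then show ?thesis by (metis near_Cons)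
    qed
  qed
qed

lemma minor_excluded_of_near_map:
  fixes f :: "'a \<Rightarrow> 'b list"
  assumes A: "finite A" "\<And>v. v \<in> pverts \<Gamma> \<Longrightarrow> set (f v) \<subseteq> A"
    and near: "\<And>u v. (u, v) \<in> parcs \<Gamma> \<Longrightarrow> near L (f u) (f v)"
    and fibre: "\<And>w. finite {v \<in> pverts \<Gamma>. f v = w}" "\<And>w. card {v \<in> pverts \<Gamma>. f v = w} \<le> k"
  shows "minor_excluded \<Gamma>"
proof -
  obtain N where N: "\<And>p. finite {w. set w \<subseteq> A \<and> near (Suc L) p w}"
    "\<And>p. card {w. set w \<subseteq> A \<and> near (Suc L) p w} \<le> N"
    by (rule card_near_le[OF A(1), of "Suc L"]) (rule that; blast)
  \<comment> \<open>One more than the number of vertices that can map near a single word;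
    \<open>M\<close> is the complete graph on \<open>m\<close> vertices.\<close>
  define m where "m = Suc (N * k)"
  define M :: "nat pair_pre_digraph" where
    "M = \<lparr>pverts = {..<m}, parcs = {(i, j). i < m \<and> j < m \<and> i \<noteq> j}\<rparr>"
  have "pair_graph M"
  proof
    have "parcs M \<subseteq> {..<m} \<times> {..<m}" by (auto simp: M_def)
    then show "finite (parcs M)" by (rule finite_subset) simp
    show "symmetric (with_proj M)"
      by (auto simp: M_def symmetric_def intro!: symI)
  qed (auto simp: M_def)
  moreover have "\<not> is_minor M \<Gamma>"
  proof
    assume "is_minor M \<Gamma>"
    then obtain B :: "nat \<Rightarrow> 'a pair_pre_digraph" where
      B: "\<And>i. i < m \<Longrightarrow> pair_graph (B i)"
      "\<And>i. i < m \<Longrightarrow> subgraph (with_proj (B i)) (with_proj \<Gamma>)"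
      "\<And>i. i < m \<Longrightarrow> connected (with_proj (B i))"
      and disj: "\<And>i j. i < m \<Longrightarrow> j < m \<Longrightarrow> i \<noteq> j \<Longrightarrow> pverts (B i) \<inter> pverts (B j) = {}"
      and touch: "\<And>i j. i < m \<Longrightarrow> j < m \<Longrightarrow> i \<noteq> j \<Longrightarrow>
        \<exists>x\<in>pverts (B i). \<exists>y\<in>pverts (B j). (x, y) \<in> parcs \<Gamma>"
      unfolding is_minor_def M_def by fastforce
    have sub: "pverts (B i) \<subseteq> pverts \<Gamma>" "parcs (B i) \<subseteq> parcs \<Gamma>"
      "parcs (B i) \<subseteq> pverts (B i) \<times> pverts (B i)" if "i < m" for i
    proof -
      interpret pair_graph "B i" using B(1)[OF that] .
      show "pverts (B i) \<subseteq> pverts \<Gamma>" "parcs (B i) \<subseteq> parcs \<Gamma>"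
        using B(2)[OF that] by (auto simp: subgraph_def)
      show "parcs (B i) \<subseteq> pverts (B i) \<times> pverts (B i)"
        using in_arcsD1 in_arcsD2 by auto
    qed
    have "pverts (B i) \<noteq> {}" if "i < m" for i
      using B(3)[OF that] by (auto simp: connected_def strongly_connected_def)
    then have "\<forall>i. \<exists>x. i < m \<longrightarrow> x \<in> pverts (B i)"
      by blast
    then obtain b where b: "\<And>i. i < m \<Longrightarrow> b i \<in> pverts (B i)"
      by metis
    define common where "common p \<longleftrightarrow> (\<exists>i<m. \<forall>z\<in>pverts (B i). suffix p (f z))" for p
    have "common []" unfolding common_def m_def by auto
    \<comment> \<open>Such a \<open>p\<close> is a suffix of some \<open>f (b i)\<close>. The sum
      bounds these lengths for all \<open>i\<close> at once, so a longest \<open>p\<close>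
      exists.\<close>
    moreover have "length p < Suc (\<Sum>i<m. length (f (b i)))" if "common p" for p
    proof -
      obtain i where i: "i < m" "suffix p (f (b i))"
        using \<open>common p\<close> b unfolding common_def by blast
      then have "length p \<le> length (f (b i))" by (simp add: suffix_length_le)
      also have "\<dots> \<le> (\<Sum>i<m. length (f (b i)))"
        using i by (intro member_le_sum) auto
      finally show ?thesis by simp
    qed
    ultimately obtain p where p: "common p" "\<And>q. common q \<Longrightarrow> length q \<le> length p"
      using ex_has_greatest_nat[of common "[]" length] by blast
    then obtain i where i: "i < m" "\<And>z. z \<in> pverts (B i) \<Longrightarrow> suffix p (f z)"
      unfolding common_def by blast
    \<comment> \<open>A branch set below a child of \<open>p\<close> would make that longer word
      \<open>common\<close>. This covers \<open>j = i\<close> too.\<close>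
    have max: "\<exists>z\<in>pverts (B j). \<not> suffix (a # p) (f z)" if "j < m" for a j
      using p(2)[of "a # p"] that unfolding common_def by auto
    have "\<exists>z\<in>pverts (B j). near (Suc L) p (f z)" if j: "j < m" for j
    proof -
      \<comment> \<open>For \<open>j = i\<close> the vertex \<open>b i\<close> plays both roles;
        otherwise the minor's edge from \<open>B i\<close> to \<open>B j\<close> supplies the
        pair.\<close>
      obtain x y where "suffix p (f x)" "y \<in> pverts (B j)" "near L (f x) (f y)"
      proof (cases "j = i")
        case True
        then show ?thesis using that[of "b i" "b i"] i b near_refl by blast
      next
        case False
        then show ?thesis using that touch[OF i(1) j] i near by blast
      qed
      then show ?thesis
        using sub[OF j] near max[OF j]
        by (intro connected_near_word[OF B(3)[OF j], of L f y x p]) blast+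
    qed
    then obtain z where z: "\<And>j. j < m \<Longrightarrow> z j \<in> pverts (B j)"
      "\<And>j. j < m \<Longrightarrow> near (Suc L) p (f (z j))"
      by metis
    \<comment> \<open>The \<open>m\<close> vertices \<open>z j\<close> are distinct by disjointness
      of the branch sets, yet all lie in the fibres over the words near \<open>p\<close>.\<close>
    let ?W = "{w. set w \<subseteq> A \<and> near (Suc L) p w}"
    let ?U = "\<Union>w\<in>?W. {v \<in> pverts \<Gamma>. f v = w}"
    have "inj_on z {..<m}"
    proof (rule inj_onI)
      fix j j' assume "j \<in> {..<m}" "j' \<in> {..<m}" "z j = z j'"
      then show "j = j'" using z(1)[of j] z(1)[of j'] disj[of j j'] by auto
    qed
    moreover have "z ` {..<m} \<subseteq> ?U"
    proof (rule image_subsetI)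
      fix j assume "j \<in> {..<m}"
      then have "z j \<in> pverts \<Gamma>" "near (Suc L) p (f (z j))"
        using z sub(1) by auto
      then show "z j \<in> ?U" using A(2) by auto
    qed
    moreover have "finite ?U" using N(1) fibre(1) by blast
    ultimately have "card {..<m} \<le> card ?U"
      by (rule card_inj_on_le)
    also have "\<dots> \<le> (\<Sum>w\<in>?W. card {v \<in> pverts \<Gamma>. f v = w})"
      by (rule card_UN_le[OF N(1)])
    also have "\<dots> \<le> card ?W * k"
      using sum_bounded_above[of ?W "\<lambda>w. card {v \<in> pverts \<Gamma>. f v = w}" k] fibre(2) by simp
    also have "\<dots> \<le> N * k" using N(2) by simp
    finally show False by (simp add: m_def)
  qed
  ultimately show ?thesis unfolding minor_excluded_def by blast
qed


section \<open>Virtually free groups\<close>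

text \<open>
  Edges of the Cayley graph multiply on the left, so a transversal of the left cosets \<open>t H\<close> is
  needed; inversion supplies one from the right cosets.
\<close>

lemma (in group) finite_left_transversal:
  assumes H: "subgroup H G" and fin: "finite (rcosets H)"
  obtains T where "finite T" "T \<subseteq> carrier G" "\<And>u. u \<in> carrier G \<Longrightarrow> \<exists>t\<in>T. inv t \<otimes> u \<in> H"
proof
  define r where "r C = (SOME x. x \<in> C)" for C :: "'a set"
  have r: "r (H #> x) \<in> H #> x" if "x \<in> carrier G" for x
    unfolding r_def by (rule someI, rule rcos_self[OF that H])
  show "finite ((\<lambda>C. inv (r C)) ` (rcosets H))" using fin by simp
  have rc: "r (H #> x) \<in> carrier G" if "x \<in> carrier G" for x
    using r[OF that] r_coset_subset_G[OF subgroup.subset[OF H] that] by blast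
  then show "(\<lambda>C. inv (r C)) ` (rcosets H) \<subseteq> carrier G"
    by (auto simp: RCOSETS_def)
  fix u assume u: "u \<in> carrier G"
  let ?r = "r (H #> inv u)"
  obtain h where h: "h \<in> H" "?r = h \<otimes> inv u"
    using r[of "inv u"] u by (auto simp: r_coset_def)
  moreover have "h \<in> carrier G" using h subgroup.subset[OF H] by blast
  \<comment> \<open>With \<open>t = inv ?r\<close>, the product \<open>inv t \<otimes> u\<close> is
    \<open>h \<otimes> inv u \<otimes> u = h\<close>.\<close>
  ultimately have "inv (inv ?r) \<otimes> u \<in> H"
    using u by (simp add: m_assoc)
  moreover have "H #> inv u \<in> rcosets H"
    using u by (auto simp: RCOSETS_def)
  ultimately show "\<exists>t\<in>(\<lambda>C. inv (r C)) ` (rcosets H). inv t \<otimes> u \<in> H"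
    by blast
qed

theorem theorem3p6:
  fixes G :: "('a, 'b) monoid_scheme" and H S :: "'a set" and n :: nat
  assumes "group G"
    and "subgroup H G"
    and "G\<lparr>carrier := H\<rparr> \<cong> free_group n"
    and "finite (rcosets\<^bsub>G\<^esub> H)"
    and "symmetric_generating_set G S"
  shows "minor_excluded (cayley_graph G S)"
proof -
  interpret group G by fact
  have S: "finite S" "S \<subseteq> carrier G"
    using assms(5) by (auto simp: symmetric_generating_set_def)
  obtain \<phi> where "\<phi> \<in> iso (G\<lparr>carrier := H\<rparr>) (free_group n)"
    using assms(3) by (auto simp: is_iso_def)
  then have bij: "bij_betw \<phi> H (carrier (free_group n))"
    and mult: "\<And>x y. x \<in> H \<Longrightarrow> y \<in> H \<Longrightarrow> \<phi> (x \<otimes>\<^bsub>G\<^esub> y) = foldr push_letter (\<phi> x) (\<phi> y)"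
    by (auto simp: iso_def hom_def free_group_def)
  obtain T where T: "finite T" "T \<subseteq> carrier G" "\<And>u. u \<in> carrier G \<Longrightarrow> \<exists>t\<in>T. inv\<^bsub>G\<^esub> t \<otimes>\<^bsub>G\<^esub> u \<in> H"
    using finite_left_transversal[OF assms(2,4)] by blast
  then obtain \<tau> where \<tau>: "\<And>u. u \<in> carrier G \<Longrightarrow> \<tau> u \<in> T"
    "\<And>u. u \<in> carrier G \<Longrightarrow> inv\<^bsub>G\<^esub> (\<tau> u) \<otimes>\<^bsub>G\<^esub> u \<in> H"
    by metis
  have \<tau>G: "\<tau> u \<in> carrier G" if "u \<in> carrier G" for u
    using \<tau> T that by blast
  define \<eta> where "\<eta> u = inv\<^bsub>G\<^esub> (\<tau> u) \<otimes>\<^bsub>G\<^esub> u" for u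
  \<comment> \<open>If \<open>u = s v\<close>, then \<open>\<eta> u\<close> is
    \<open>\<eta> v\<close> multiplied on the left by an element of this finite set.\<close>
  define D where "D = (\<lambda>(t, s, t'). inv\<^bsub>G\<^esub> t \<otimes>\<^bsub>G\<^esub> s \<otimes>\<^bsub>G\<^esub> t') ` (T \<times> S \<times> T)"
  have D: "finite D" unfolding D_def using T S by simp
  \<comment> \<open>Elements of \<open>D\<close> outside \<open>H\<close> contribute arbitrary
    lengths, which can only enlarge the bound.\<close>
  define L where "L = (\<Sum>d\<in>D. length (\<phi> d))"
  show ?thesis
  proof (rule minor_excluded_of_near_map)
    show "finite ({..<n} \<times> (UNIV :: bool set))" by simp
    show "set (\<phi> (\<eta> v)) \<subseteq> {..<n} \<times> UNIV" if "v \<in> pverts (cayley_graph G S)" for v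
    proof -
      have "\<phi> (\<eta> v) \<in> carrier (free_group n)"
        using bij that \<tau> by (auto simp: cayley_graph_def \<eta>_def bij_betw_def)
      then show ?thesis by (simp add: free_group_def)
    qed
    show "near L (\<phi> (\<eta> u)) (\<phi> (\<eta> v))" if "(u, v) \<in> parcs (cayley_graph G S)" for u v
    proof -
      obtain s where s: "u \<in> carrier G" "v \<in> carrier G" "s \<in> S" "s \<in> carrier G" "u = s \<otimes>\<^bsub>G\<^esub> v"
      proof -
        have "u \<in> carrier G \<and> v \<in> carrier G \<and> (\<exists>s\<in>S. u = s \<otimes>\<^bsub>G\<^esub> v)"
          using \<open>(u, v) \<in> parcs (cayley_graph G S)\<close> by (simp add: cayley_graph_def)
        then show thesis using that S(2) by blast
      qed
      define d where "d = inv\<^bsub>G\<^esub> (\<tau> u) \<otimes>\<^bsub>G\<^esub> s \<otimes>\<^bsub>G\<^esub> \<tau> v"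
      have dG: "d \<in> carrier G" using s \<tau>G by (simp add: d_def)
      have "d \<otimes>\<^bsub>G\<^esub> \<eta> v = inv\<^bsub>G\<^esub> (\<tau> u) \<otimes>\<^bsub>G\<^esub> s \<otimes>\<^bsub>G\<^esub> (\<tau> v \<otimes>\<^bsub>G\<^esub> (inv\<^bsub>G\<^esub> (\<tau> v) \<otimes>\<^bsub>G\<^esub> v))"
        using s \<tau>G by (simp add: d_def \<eta>_def m_assoc)
      also have "\<tau> v \<otimes>\<^bsub>G\<^esub> (inv\<^bsub>G\<^esub> (\<tau> v) \<otimes>\<^bsub>G\<^esub> v) = v"
        using s \<tau>G by (simp flip: m_assoc)
      finally have eq: "\<eta> u = d \<otimes>\<^bsub>G\<^esub> \<eta> v"
        using s \<tau>G by (simp add: \<eta>_def m_assoc)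
      have \<eta>: "\<eta> u \<in> H" "\<eta> v \<in> H" using \<tau> s by (auto simp: \<eta>_def)
      \<comment> \<open>Membership of \<open>d\<close> in \<open>H\<close> is what lets \<phi> turn
        multiplication by \<open>d\<close> into pushing the word \<open>\<phi> d\<close>.\<close>
      have "d = \<eta> u \<otimes>\<^bsub>G\<^esub> inv\<^bsub>G\<^esub> (\<eta> v)"
        using eq dG \<eta> subgroup.subset[OF assms(2)] by (simp add: inv_solve_right subset_iff)
      then have dH: "d \<in> H"
        using \<eta> assms(2) by (simp add: subgroup.m_closed subgroup.m_inv_closed)
      have "d \<in> D"
        unfolding D_def d_def
        by (rule image_eqI[of _ _ "(\<tau> u, s, \<tau> v)"]) (use \<tau> s in auto)
      then have "length (\<phi> d) \<le> L"
        unfolding L_def using D by (intro member_le_sum) auto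
      then show ?thesis
        unfolding eq mult[OF dH \<eta>(2)] using near_foldr_push near_mono by blast
    qed
    fix w
    \<comment> \<open>By injectivity of \<phi> on \<open>H\<close>, the word \<open>w\<close>
      determines \<open>\<eta> v\<close>, so \<open>v = \<tau> v \<otimes> \<eta> v\<close> is
      determined by its representative in \<open>T\<close>.\<close>
    have sub: "{v \<in> pverts (cayley_graph G S). \<phi> (\<eta> v) = w} \<subseteq> (\<lambda>t. t \<otimes>\<^bsub>G\<^esub> inv_into H \<phi> w) ` T"
    proof clarify
      fix v assume "v \<in> pverts (cayley_graph G S)"
      then have v: "v \<in> carrier G" by (simp add: cayley_graph_def)
      then have "\<eta> v \<in> H" using \<tau> by (simp add: \<eta>_def)
      then have "inv_into H \<phi> (\<phi> (\<eta> v)) = \<eta> v"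
        using bij by (simp add: bij_betw_def inv_into_f_f)
      moreover have "\<tau> v \<otimes>\<^bsub>G\<^esub> \<eta> v = v"
        using v \<tau>G by (simp add: \<eta>_def flip: m_assoc)
      ultimately show "v \<in> (\<lambda>t. t \<otimes>\<^bsub>G\<^esub> inv_into H \<phi> (\<phi> (\<eta> v))) ` T"
        using \<tau> v by (metis image_eqI)
    qed
    show "finite {v \<in> pverts (cayley_graph G S). \<phi> (\<eta> v) = w}"
      using finite_subset[OF sub] T by blast
    show "card {v \<in> pverts (cayley_graph G S). \<phi> (\<eta> v) = w} \<le> card T"
      using surj_card_le[OF T(1) sub] .
  qed
qed

end
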